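(* Let $G\in\mathbb{Np}^\infty$ be any form and let $H\in\mathbb{Np}^\infty$ be invertible with inverse $-H$. Then $G\succcurlyeq H$ if and only if $o(G+(-H))\in\{\mathscr L,\mathscr P\}$, and $G=H$ if and only if $o(G+(-H))=\mathscr P$.
   Context: Affine normal play forms $\mathbb{Np}^\infty$ are defined recursively: two atomic forms $\infty$ and $\overline{\infty}$ with no options; every other form is $G=\{G^{\mathcal L}\mid G^{\mathcal R}\}$ with finite nonempty sets of previously constructed forms as Left and Right options. Disjunctive sum: $\infty+X=X+\infty=\infty$ for $X\neq\overline{\infty}$; $\overline{\infty}+X=X+\overline{\infty}=\overline{\infty}$ for $X\ne\infty$; $\infty+\overline{\infty}$ undefined; otherwise $G+H=\{G^L+H,G+H^L\mid G^R+H,G+H^R\}$. Outcomes: Left wins $\infty$ and Right wins $\overline{\infty}$ whoever moves; otherwise play alternates, Left moving first wins iff some Left option is won by Left moving second, Left moving second wins iff every Right option is won by Left moving first, symmetrically for Right. $o(G)\in\{\mathscr L,\mathscr N,\mathscr P,\mathscr R\}$ (Left wins either way, first player wins, second player wins, Right wins either way), ordered $\mathscr L>\mathscr N,\mathscr P>\mathscr R$ with $\mathscr N,\mathscr P$ incomparable. $G\succcurlyeq H$ means $o(G+X)\geqslant o(H+X)$ for all $X\in\mathbb{Np}^\infty\setminus\{\infty,\overline\infty\}$; $G=H$ means both directions. $0=\{\overline\infty\mid\infty\}$. $H$ is invertible if there is $K\in\mathbb{Np}^\infty$ with $H+K=0$; such $K$ is denoted $-H$. *)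

theory Defs
  imports "HOL-Library.FSet"
begin

text \<open>
  Forms over finite sets of options. The datatype also contains forms with an empty set of
  options; the class of affine normal play forms is the carrier set \<open>Np\<close> below.
\<close>

datatype form = PosInf | NegInf | Form "form fset" "form fset"

inductive_set Np :: "form set" where
  "PosInf \<in> Np"
| "NegInf \<in> Np"
| "L \<noteq> {||} \<Longrightarrow> R \<noteq> {||} \<Longrightarrow> (\<And>X. X |\<in>| L \<Longrightarrow> X \<in> Np) \<Longrightarrow> (\<And>X. X |\<in>| R \<Longrightarrow> X \<in> Np) \<Longrightarrow>
   Form L R \<in> Np"

lemma size_fmember_less:
  assumes "X |\<in>| L"
  shows "size X < size (Form L R)" "size X < size (Form R L)"
proof -
  have "size X \<le> (\<Sum>Y\<in>fset L. Suc (size Y))"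
    using member_le_sum[of X "fset L" "\<lambda>Y. Suc (size Y)"] assms by force
  then show "size X < size (Form L R)" "size X < size (Form R L)"
    by auto
qed

text \<open>
  Disjunctive sum. It is left undefined exactly when the two summands are opposite infinities;
  as \<open>undefined\<close> is some unknown form, uses of the sum have to exclude that case.
\<close>

definition sum_defined :: "form \<Rightarrow> form \<Rightarrow> bool" where
  "sum_defined G H \<longleftrightarrow> {G, H} \<noteq> {PosInf, NegInf}"

function add :: "form \<Rightarrow> form \<Rightarrow> form"  (infixl \<open>\<oplus>\<close> 65) where
  "PosInf \<oplus> NegInf = undefined"
| "NegInf \<oplus> PosInf = undefined"
| "X \<noteq> NegInf \<Longrightarrow> PosInf \<oplus> X = PosInf"
| "X \<noteq> PosInf \<Longrightarrow> NegInf \<oplus> X = NegInf"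
| "Form L R \<oplus> PosInf = PosInf"
| "Form L R \<oplus> NegInf = NegInf"
| "Form L R \<oplus> Form L' R' =
     Form ((\<lambda>X. X \<oplus> Form L' R') |`| L |\<union>| (\<lambda>Y. Form L R \<oplus> Y) |`| L')
          ((\<lambda>X. X \<oplus> Form L' R') |`| R |\<union>| (\<lambda>Y. Form L R \<oplus> Y) |`| R')"
  by (auto, metis form.exhaust)
termination
  by (relation "measure (\<lambda>(G, H). size G + size H)") (auto simp del: form.size intro: size_fmember_less)

datatype player = Left | Right

fun opponent :: "player \<Rightarrow> player" where
  "opponent Left = Right"
| "opponent Right = Left"

text \<open>\<open>wins p s G\<close>: player \<open>p\<close> wins \<open>G\<close> when player \<open>s\<close> moves first.\<close>

function wins :: "player \<Rightarrow> player \<Rightarrow> form \<Rightarrow> bool" where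
  "wins p s PosInf \<longleftrightarrow> p = Left"
| "wins p s NegInf \<longleftrightarrow> p = Right"
| "wins p s (Form L R) \<longleftrightarrow>
     (let Opts = (case s of Left \<Rightarrow> L | Right \<Rightarrow> R) in
      if p = s then \<exists>X\<in>fset Opts. wins p (opponent s) X
      else \<forall>X\<in>fset Opts. wins p (opponent s) X)"
  by pat_completeness auto
termination
  by (relation "measure (\<lambda>(p, s, G). size G)")
     (auto simp del: form.size intro: size_fmember_less split: player.splits)

datatype outcome = OutL | OutN | OutP | OutR

instantiation outcome :: order
begin

definition less_eq_outcome :: "outcome \<Rightarrow> outcome \<Rightarrow> bool" where
  "a \<le> b \<longleftrightarrow> a = b \<or> a = OutR \<or> b = OutL"

definition less_outcome :: "outcome \<Rightarrow> outcome \<Rightarrow> bool" where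
  "a < b \<longleftrightarrow> a \<le> b \<and> a \<noteq> (b :: outcome)"

instance
  by standard (auto simp: less_eq_outcome_def less_outcome_def)

end

lemma wins_Right_iff: "wins Right s G \<longleftrightarrow> \<not> wins Left s G"
proof (induction G arbitrary: s)
  case (Form L R)
  then show ?case by (cases s) simp_all
qed simp_all

definition outcome :: "form \<Rightarrow> outcome" where
  "outcome G =
     (if wins Left Left G \<and> wins Left Right G then OutL
      else if wins Left Left G \<and> wins Right Right G then OutN
      else if wins Right Left G \<and> wins Left Right G then OutP
      else OutR)"

lemma outcome_eq_OutR: "outcome G = OutR \<longleftrightarrow> wins Right Left G \<and> wins Right Right G"
  by (auto simp: outcome_def wins_Right_iff)

definition game_ge :: "form \<Rightarrow> form \<Rightarrow> bool"  (infix \<open>\<succeq>\<close> 50) where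
  "G \<succeq> H \<longleftrightarrow> (\<forall>X \<in> Np - {PosInf, NegInf}. outcome (G \<oplus> X) \<ge> outcome (H \<oplus> X))"

definition game_eq :: "form \<Rightarrow> form \<Rightarrow> bool"  (infix \<open>\<approx>\<close> 50) where
  "G \<approx> H \<longleftrightarrow> G \<succeq> H \<and> H \<succeq> G"

definition zero_form :: form where
  "zero_form = Form {|NegInf|} {|PosInf|}"

text \<open>The equality in ``\<open>H + K = 0\<close>'' is game equality \<open>\<approx>\<close>.\<close>

definition is_inverse :: "form \<Rightarrow> form \<Rightarrow> bool" where
  "is_inverse H K \<longleftrightarrow> K \<in> Np \<and> sum_defined H K \<and> H \<oplus> K \<approx> zero_form"

lemma add_PosInf [simp]: "X \<noteq> NegInf \<Longrightarrow> X \<oplus> PosInf = PosInf"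
  by (cases X) auto

lemma add_NegInf [simp]: "X \<noteq> PosInf \<Longrightarrow> X \<oplus> NegInf = NegInf"
  by (cases X) auto

lemma add_in_Np:
  assumes "G \<in> Np" "H \<in> Np" "sum_defined G H"
  shows "G \<oplus> H \<in> Np"
  using assms
proof (induction G H rule: add.induct)
  case (7 L R L' R')
  then have "\<And>X. X |\<in>| L |\<union>| R \<Longrightarrow> X \<in> Np" "\<And>X. X |\<in>| L' |\<union>| R' \<Longrightarrow> X \<in> Np" "L \<noteq> {||}" "R \<noteq> {||}"
    by (auto elim: Np.cases)
  with 7 show ?case
    by (auto simp: sum_defined_def doubleton_eq_iff intro!: Np.intros(3))
qed (auto simp: sum_defined_def intro: Np.intros)

lemma zero_form_in_Np: "zero_form \<in> Np"
  by (auto simp: zero_form_def intro: Np.intros)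

text \<open>Invertible forms and their inverses are not atomic, so adding them is always defined.\<close>

lemma is_inverse_not_atomic:
  assumes "is_inverse H K"
  shows "H \<notin> {PosInf, NegInf}" "K \<notin> {PosInf, NegInf}"
proof -
  have zz: "outcome (zero_form \<oplus> zero_form) = OutP"
    by (simp add: zero_form_def outcome_def)
  have "zero_form \<in> Np - {PosInf, NegInf}"
    using zero_form_in_Np by (simp add: zero_form_def)
  then have "outcome (H \<oplus> K \<oplus> zero_form) = OutP"
    using assms zz unfolding is_inverse_def game_eq_def game_ge_def by (metis order_antisym)
  moreover have "outcome (PosInf \<oplus> zero_form) = OutL" "outcome (NegInf \<oplus> zero_form) = OutR"
    by (simp_all add: zero_form_def outcome_def)
  ultimately have "H \<oplus> K \<noteq> PosInf" "H \<oplus> K \<noteq> NegInf"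
    by auto
  moreover have "sum_defined H K"
    using assms by (simp add: is_inverse_def)
  ultimately show "H \<notin> {PosInf, NegInf}" "K \<notin> {PosInf, NegInf}"
    by (cases H; cases K; auto simp: sum_defined_def insert_commute)+
qed

end

(* If the player moving second wins A, they can answer every move in A locally, so adding A never
   hurts them: the outcome of A + Y is at least as good for them as that of Y. Applied to
   A = G + K and Y = H + X, this compares G + X, which has the outcome of (G + X) + (H + K), with
   H + X. The converse is the special case X = K of the definition of the order, because H + K
   has the outcome of 0. *)

theory Submission
  imports Defs
begin

text \<open>No definedness condition is needed: the sums of opposite infinities in either order are
  the same constant \<open>undefined\<close>.\<close>

lemma add_commute: "A \<oplus> B = B \<oplus> A"
proof (induction A B rule: add.induct)
  case (7 L R L' R')
  then have "(\<lambda>X. X \<oplus> Form L' R') |`| L = (\<lambda>X. Form L' R' \<oplus> X) |`| L"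
    and "(\<lambda>X. X \<oplus> Form L' R') |`| R = (\<lambda>X. Form L' R' \<oplus> X) |`| R"
    and "(\<lambda>Y. Form L R \<oplus> Y) |`| L' = (\<lambda>Y. Y \<oplus> Form L R) |`| L'"
    and "(\<lambda>Y. Form L R \<oplus> Y) |`| R' = (\<lambda>Y. Y \<oplus> Form L R) |`| R'"
    by (auto intro!: fset.map_cong0)
  then show ?case
    by (simp add: funion_commute)
qed auto

lemma add_not_atomic:
  assumes "A \<notin> {PosInf, NegInf}" "B \<notin> {PosInf, NegInf}"
  shows "A \<oplus> B \<notin> {PosInf, NegInf}"
  using assms by (cases A; cases B) auto

lemma add_assoc:
  assumes "A \<notin> {PosInf, NegInf}" "B \<notin> {PosInf, NegInf}" "C \<notin> {PosInf, NegInf}"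
  shows "A \<oplus> B \<oplus> C = A \<oplus> (B \<oplus> C)"
  using assms
proof (induction "size A + size B + size C" arbitrary: A B C rule: less_induct)
  case less
  from less.prems obtain L R L' R' L'' R''
    where A: "A = Form L R" and B: "B = Form L' R'" and C: "C = Form L'' R''"
    by (cases A; cases B; cases C) auto
  \<comment> \<open>Options may be atomic, where the induction hypothesis does not apply. The other
    two summands are not, so both sides collapse to \<open>X\<close>.\<close>
  have atomic: "X \<oplus> B \<oplus> C = X \<oplus> (B \<oplus> C)" "A \<oplus> X \<oplus> C = A \<oplus> (X \<oplus> C)" "A \<oplus> B \<oplus> X = A \<oplus> (B \<oplus> X)"
    if "X \<in> {PosInf, NegInf}" for X
    using that by (auto simp: A B C)
  have 1: "X \<oplus> B \<oplus> C = X \<oplus> (B \<oplus> C)" if "X |\<in>| L |\<union>| R" for X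
  proof (cases "X \<in> {PosInf, NegInf}")
    case False
    have "size X < size A"
      using that size_fmember_less unfolding A by auto
    then show ?thesis
      using less False by auto
  qed (rule atomic)
  have 2: "A \<oplus> X \<oplus> C = A \<oplus> (X \<oplus> C)" if "X |\<in>| L' |\<union>| R'" for X
  proof (cases "X \<in> {PosInf, NegInf}")
    case False
    have "size X < size B"
      using that size_fmember_less unfolding B by auto
    then show ?thesis
      using less False by auto
  qed (rule atomic)
  have 3: "A \<oplus> B \<oplus> X = A \<oplus> (B \<oplus> X)" if "X |\<in>| L'' |\<union>| R''" for X
  proof (cases "X \<in> {PosInf, NegInf}")
    case False
    have "size X < size C"
      using that size_fmember_less unfolding C by auto
    then show ?thesis
      using less False by auto
  qed (rule atomic)
  have "(\<lambda>X. X \<oplus> B \<oplus> C) |`| M = (\<lambda>X. X \<oplus> (B \<oplus> C)) |`| M" if "M |\<subseteq>| L |\<union>| R" for M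
    using that 1 by (intro fset.map_cong0) auto
  moreover have "(\<lambda>X. A \<oplus> X \<oplus> C) |`| M = (\<lambda>X. A \<oplus> (X \<oplus> C)) |`| M" if "M |\<subseteq>| L' |\<union>| R'" for M
    using that 2 by (intro fset.map_cong0) auto
  moreover have "(\<lambda>X. A \<oplus> B \<oplus> X) |`| M = (\<lambda>X. A \<oplus> (B \<oplus> X)) |`| M" if "M |\<subseteq>| L'' |\<union>| R''" for M
    using that 3 by (intro fset.map_cong0) auto
  ultimately show ?case
    by (simp add: A B C fimage_funion fset.map_comp o_def funion_assoc)
qed

text \<open>Moving in \<open>zero_form\<close> turns the sum into the infinity won by the opponent,
  so this extra move never helps the mover.\<close>

lemma wins_add_zero: "wins p s (G \<oplus> zero_form) \<longleftrightarrow> wins p s G"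
proof -
  have "wins Left s (G \<oplus> zero_form) \<longleftrightarrow> wins Left s G" for s
  proof (induction G arbitrary: s)
    case (Form L R)
    then show ?case
      by (cases s) (auto simp: zero_form_def)
  qed (auto simp: zero_form_def)
  then show ?thesis
    by (cases p) (auto simp: wins_Right_iff)
qed

text \<open>The three claims need each other. After a move of the opponent in \<open>A\<close> or
  \<open>B\<close>, the second or third claim supplies the reply; after a winning move of
  \<open>p\<close>, the first claim applies to the option reached. Opposite infinities never meet,
  since \<open>p\<close> cannot win both.\<close>

lemma wins_add_cases:
  "(wins p (opponent p) A \<longrightarrow> wins p (opponent p) B \<longrightarrow> wins p (opponent p) (A \<oplus> B)) \<and>
   (wins p p A \<longrightarrow> wins p (opponent p) B \<longrightarrow> wins p p (A \<oplus> B)) \<and>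
   (wins p (opponent p) A \<longrightarrow> wins p p B \<longrightarrow> wins p p (A \<oplus> B))"
proof (induction A B rule: add.induct)
  case (7 L R L' R')
  show ?case
  proof (cases p)
    case Left
    note IH = 7[unfolded Left opponent.simps]
    have "wins Left Right (Form L R \<oplus> Form L' R')"
      if "wins Left Right (Form L R)" "wins Left Right (Form L' R')"
      using that IH(3,4) by auto
    moreover have "wins Left Left (Form L R \<oplus> Form L' R')"
      if "wins Left Left (Form L R)" "wins Left Right (Form L' R')"
      using that IH(1) by auto
    moreover have "wins Left Left (Form L R \<oplus> Form L' R')"
      if "wins Left Right (Form L R)" "wins Left Left (Form L' R')"
      using that IH(2) by auto
    ultimately show ?thesis
      unfolding Left opponent.simps by blast
  next
    case Right
    note IH = 7[unfolded Right opponent.simps]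
    have "wins Right Left (Form L R \<oplus> Form L' R')"
      if "wins Right Left (Form L R)" "wins Right Left (Form L' R')"
      using that IH(1,2) by auto
    moreover have "wins Right Right (Form L R \<oplus> Form L' R')"
      if "wins Right Right (Form L R)" "wins Right Left (Form L' R')"
      using that IH(3) by auto
    moreover have "wins Right Right (Form L R \<oplus> Form L' R')"
      if "wins Right Left (Form L R)" "wins Right Right (Form L' R')"
      using that IH(4) by auto
    ultimately show ?thesis
      unfolding Right opponent.simps by blast
  qed
qed auto

lemma wins_add:
  assumes "wins p (opponent p) A" "wins p s B"
  shows "wins p s (A \<oplus> B)"
  using assms wins_add_cases[of p A B] by (cases p; cases s) auto

text \<open>An outcome amounts to the set of starting players with which Left wins, and the order on
  outcomes is inclusion of these sets.\<close>

lemma outcome_le_iff: "outcome A \<le> outcome B \<longleftrightarrow> (\<forall>s. wins Left s A \<longrightarrow> wins Left s B)"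
proof -
  have "(\<forall>s. Q s) \<longleftrightarrow> Q Left \<and> Q Right" for Q
    by (auto intro: player.induct)
  then show ?thesis
    by (auto simp: outcome_def less_eq_outcome_def wins_Right_iff)
qed

lemma outcome_cong: "(\<And>s. wins Left s A \<longleftrightarrow> wins Left s B) \<Longrightarrow> outcome A = outcome B"
  by (simp add: outcome_def wins_Right_iff)

lemma outcome_add_zero [simp]: "outcome (G \<oplus> zero_form) = outcome G"
  by (rule outcome_cong) (rule wins_add_zero)

lemma outcome_le_add:
  assumes "outcome A \<in> {OutL, OutP}"
  shows "outcome B \<le> outcome (A \<oplus> B)"
proof -
  have "wins Left Right A"
    using assms by (auto simp: outcome_def wins_Right_iff split: if_splits)
  then show ?thesis
    using wins_add[of Left A] by (auto simp: outcome_le_iff)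
qed

text \<open>Each player wins \<open>A\<close> moving second, so adding \<open>A\<close> hurts
  neither of them.\<close>

lemma outcome_add_eq:
  assumes "outcome A = OutP"
  shows "outcome (A \<oplus> B) = outcome B"
proof (rule outcome_cong)
  have "wins Left Right A" "wins Right Left A"
    using assms by (auto simp: outcome_def wins_Right_iff split: if_splits)
  then show "wins Left s (A \<oplus> B) \<longleftrightarrow> wins Left s B" for s
    using wins_add[of Left A s B] wins_add[of Right A s B] by (auto simp: wins_Right_iff)
qed

lemma outcome_zero [simp]: "outcome zero_form = OutP"
  by (simp add: zero_form_def outcome_def)

lemma outcome_inverse:
  assumes "is_inverse H K"
  shows "outcome (H \<oplus> K) = OutP"
proof -
  have "zero_form \<in> Np - {PosInf, NegInf}"
    using zero_form_in_Np by (simp add: zero_form_def)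
  \<comment> \<open>Game equality only compares outcomes of sums with a test form;
    \<open>zero_form\<close> as test form leaves both outcomes unchanged.\<close>
  then have "outcome (H \<oplus> K \<oplus> zero_form) = outcome (zero_form \<oplus> zero_form)"
    using assms unfolding is_inverse_def game_eq_def game_ge_def by (metis order_antisym)
  then show ?thesis
    by simp
qed

lemma outcome_add_inverse_swap:
  assumes "is_inverse H K" "G \<notin> {PosInf, NegInf}" "X \<notin> {PosInf, NegInf}"
  shows "outcome (G \<oplus> X) = outcome (G \<oplus> K \<oplus> (H \<oplus> X))"
proof -
  note not_atomic = is_inverse_not_atomic[OF assms(1)]
  have "G \<oplus> K \<oplus> (H \<oplus> X) = G \<oplus> (K \<oplus> H \<oplus> X)"
    using assms not_atomic add_not_atomic by (simp only: add_assoc not_False_eq_True)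
  also have "\<dots> = G \<oplus> (X \<oplus> (H \<oplus> K))"
    by (simp only: add_commute)
  also have "\<dots> = H \<oplus> K \<oplus> (G \<oplus> X)"
    using assms not_atomic add_not_atomic add_assoc[of G X "H \<oplus> K"]
      add_commute[of "G \<oplus> X" "H \<oplus> K"] by simp
  finally show ?thesis
    using outcome_add_eq[OF outcome_inverse[OF assms(1)]] by simp
qed

theorem theorem2p13:
  fixes G H K :: form
  assumes "G \<in> Np" and "H \<in> Np" and "is_inverse H K"
  shows "(G \<succeq> H \<longleftrightarrow> outcome (G \<oplus> K) \<in> {OutL, OutP}) \<and>
         (G \<approx> H \<longleftrightarrow> outcome (G \<oplus> K) = OutP)"
proof -
  note not_atomic = is_inverse_not_atomic[OF assms(3)]
  have K: "K \<in> Np - {PosInf, NegInf}"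
    using not_atomic assms(3) by (auto simp: is_inverse_def)
  have HK: "outcome (H \<oplus> K) = OutP"
    using outcome_inverse[OF assms(3)] .
  \<comment> \<open>Both this and \<open>le\<close> take the test form \<open>X = K\<close>, which
    compares \<open>outcome (G \<oplus> K)\<close> with \<open>OutP\<close>.\<close>
  have ge: "outcome (G \<oplus> K) \<in> {OutL, OutP}" if "G \<succeq> H"
    using that K HK by (force simp: game_ge_def less_eq_outcome_def)
  have le: "outcome (G \<oplus> K) \<in> {OutR, OutP}" if "H \<succeq> G"
    using that K HK by (force simp: game_ge_def less_eq_outcome_def)
  have ge': "G \<succeq> H" if "outcome (G \<oplus> K) \<in> {OutL, OutP}"
    unfolding game_ge_def
  proof
    fix X assume X: "X \<in> Np - {PosInf, NegInf}"
    show "outcome (H \<oplus> X) \<le> outcome (G \<oplus> X)"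
    \<comment> \<open>Regrouping requires a non-atomic \<open>G\<close>. \<open>NegInf\<close> is
      ruled out because \<open>NegInf \<oplus> K\<close> has outcome \<open>OutR\<close>, and
      \<open>PosInf \<oplus> X\<close> has the greatest outcome \<open>OutL\<close>.\<close>
    proof (cases "G \<in> {PosInf, NegInf}")
      case True
      with that not_atomic X show ?thesis
        by (auto simp: outcome_def less_eq_outcome_def)
    next
      case False
      then show ?thesis
        using outcome_add_inverse_swap[OF assms(3)] outcome_le_add[OF that] X by simp
    qed
  qed
  have le': "H \<succeq> G" if P: "outcome (G \<oplus> K) = OutP"
  proof -
    \<comment> \<open>An atomic \<open>G\<close> would absorb \<open>K\<close> and give outcome
      \<open>OutL\<close> or \<open>OutR\<close>.\<close>
    have "G \<notin> {PosInf, NegInf}"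
      using P not_atomic by (auto simp: outcome_def)
    then show ?thesis
      using outcome_add_inverse_swap[OF assms(3)] outcome_add_eq[OF P] by (simp add: game_ge_def)
  qed
  show ?thesis
    using ge le ge' le' by (auto simp: game_eq_def)
qed

end
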